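(* Let $n,d\ge 1$, let $(X_1,Y_1),\dots,(X_n,Y_n)\in\mathbb{R}^d\times\mathbb{R}$ be given data points with empirical distribution $\mathbb{P}_n$, let $\delta>0$, let $q\in(1,\infty]$ and let $p$ be such that $1/p+1/q=1$. Consider the square loss $l(x,y;\beta)=(y-\beta^Tx)^2$ and the optimal transport discrepancy $\mathcal{D}_c$ with cost function $c((x,y),(u,v))=\big(N_q((x,y),(u,v))\big)^2$. Then $$\inf_{\beta\in\mathbb{R}^d}\ \sup_{\mathbb{P}:\,\mathcal{D}_c(\mathbb{P},\mathbb{P}_n)\le\delta}\mathbb{E}_{\mathbb{P}}\big[l(X,Y;\beta)\big]=\inf_{\beta\in\mathbb{R}^d}\Big(\sqrt{MSE_n(\beta)}+\sqrt{\delta}\,\|\beta\|_p\Big)^2,$$ where $MSE_n(\beta)=\mathbb{E}_{\mathbb{P}_n}[(Y-\beta^TX)^2]=\frac1n\sum_{i=1}^n(Y_i-\beta^TX_i)^2$.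
   Context: $\mathbb{P}_n=\frac1n\sum_{i=1}^n\delta_{(X_i,Y_i)}$. $\|\cdot\|_q$ is the $\ell_q$-norm. The extended-valued function $N_q$ on $\mathbb{R}^{d+1}\times\mathbb{R}^{d+1}$ is $N_q((x,y),(u,v))=\|x-u\|_q$ if $y=v$ and $N_q((x,y),(u,v))=\infty$ otherwise. For a lower semicontinuous $c:\mathbb{R}^m\times\mathbb{R}^m\to[0,\infty]$ with $c(u,u)=0$ for all $u$, and Borel probability measures $\mathbb{P},\mathbb{Q}$ on $\mathbb{R}^m$, $\mathcal{D}_c(\mathbb{P},\mathbb{Q})=\inf\{\mathbb{E}_\pi[c(U,W)]\}$, the infimum being over all joint distributions $\pi$ of $(U,W)$ on $\mathbb{R}^m\times\mathbb{R}^m$ with marginals $\pi_U=\mathbb{P}$, $\pi_W=\mathbb{Q}$; here $m=d+1$. The supremum runs over Borel probability measures $\mathbb{P}$ on $\mathbb{R}^{d+1}$, and $(X,Y)\sim\mathbb{P}$ under $\mathbb{E}_{\mathbb{P}}$. *)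

theory Defs
  imports "HOL-Probability.Probability"
begin

(* Only used for q \<ge> 1; 0 powr a = 0 holds by definition of powr. *)
definition lq_norm :: "ennreal \<Rightarrow> real ^ 'd \<Rightarrow> real" where
  "lq_norm q x =
     (if q = \<infinity> then infnorm x
      else (\<Sum>i\<in>UNIV. \<bar>x $ i\<bar> powr enn2real q) powr (1 / enn2real q))"

definition N_cost ::
    "ennreal \<Rightarrow> (real ^ 'd) \<times> real \<Rightarrow> (real ^ 'd) \<times> real \<Rightarrow> ennreal" where
  "N_cost q z w = (if snd z = snd w then ennreal (lq_norm q (fst z - fst w)) else \<infinity>)"

lemma lq_norm_zero [simp]: "lq_norm q 0 = 0"
  by (simp add: lq_norm_def infnorm_0)

lemma N_cost_self [simp]: "N_cost q z z = 0"
  by (simp add: N_cost_def)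

lemma borel_measurable_lq_norm [measurable]: "lq_norm q \<in> borel_measurable borel"
proof -
  have [measurable]: "infnorm \<in> borel_measurable (borel :: (real ^ 'd) measure)"
    by (intro borel_measurable_continuous_onI continuous_intros)
  show ?thesis unfolding lq_norm_def[abs_def] by (cases "q = \<infinity>"; simp)
qed

lemma borel_measurable_N_cost: "(\<lambda>z. N_cost q (fst z) (snd z)) \<in> borel_measurable borel"
proof -
  have [measurable]: "{z :: ((real ^ 'd) \<times> real) \<times> ((real ^ 'd) \<times> real). snd (fst z) = snd (snd z)} \<in> sets borel"
    by (intro borel_closed closed_Collect_eq continuous_intros)
  have [measurable]: "(\<lambda>z :: ((real ^ 'd) \<times> real) \<times> ((real ^ 'd) \<times> real). fst (fst z) - fst (snd z))
      \<in> borel_measurable borel"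
    by (intro borel_measurable_continuous_onI continuous_intros)
  show ?thesis unfolding N_cost_def
    by (rule measurable_If) (simp_all add: space_borel)
qed

definition couplings :: "'a::second_countable_topology measure \<Rightarrow> 'a measure \<Rightarrow> ('a \<times> 'a) measure set" where
  "couplings P Q =
     {\<pi>. prob_space \<pi> \<and> sets \<pi> = sets borel \<and> distr \<pi> borel fst = P \<and> distr \<pi> borel snd = Q}"

(* Intended for Borel measurable (e.g. lower semicontinuous) costs c. *)
definition ot_discrepancy ::
    "('a::second_countable_topology \<Rightarrow> 'a \<Rightarrow> ennreal) \<Rightarrow> 'a measure \<Rightarrow> 'a measure \<Rightarrow> ennreal" where
  "ot_discrepancy c P Q = (INF \<pi>\<in>couplings P Q. \<integral>\<^sup>+ z. c (fst z) (snd z) \<partial>\<pi>)"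

definition empirical_measure :: "nat \<Rightarrow> (nat \<Rightarrow> 'a::topological_space) \<Rightarrow> 'a measure" where
  "empirical_measure n z =
     measure_of UNIV (sets borel) (\<lambda>A. (\<Sum>i=1..n. emeasure (return borel (z i)) A) / of_nat n)"

definition sq_loss :: "real ^ 'd \<Rightarrow> real \<Rightarrow> real ^ 'd \<Rightarrow> real" where
  "sq_loss x y \<beta> = (y - \<beta> \<bullet> x)\<^sup>2"

definition mse :: "nat \<Rightarrow> (nat \<Rightarrow> real ^ 'd) \<Rightarrow> (nat \<Rightarrow> real) \<Rightarrow> real ^ 'd \<Rightarrow> real" where
  "mse n X Y \<beta> =
     (\<integral>z. sq_loss (fst z) (snd z) \<beta> \<partial>empirical_measure n (\<lambda>i. (X i, Y i)))"

lemma empirical_measure_eq_distr: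
  assumes "n \<ge> 1"
  shows "empirical_measure n z = distr (uniform_count_measure {1..n}) borel z"
proof -
  have n: "finite {1..n}" "{1..n} \<noteq> {}" using assms by auto
  have "(\<Sum>i=1..n. emeasure (return borel (z i)) A) / of_nat n
      = emeasure (distr (uniform_count_measure {1..n}) borel z) A"
    if A: "A \<in> sets borel" for A
  proof -
    have "(\<Sum>i=1..n. emeasure (return borel (z i)) A)
        = of_nat (card (z -` A \<inter> {1..n}))"
      using A n by (simp add: indicator_def sum.If_cases vimage_def Int_def conj_commute)
    moreover have "emeasure (distr (uniform_count_measure {1..n}) borel z) A
        = of_nat (card (z -` A \<inter> {1..n})) / of_nat n"
      using A assms
      by (subst emeasure_distr)
         (auto simp: measurable_def space_uniform_count_measure sets_uniform_count_measure
            emeasure_uniform_count_measure simp flip: divide_ennreal ennreal_of_nat_eq_real_of_nat)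
    ultimately show ?thesis by simp
  qed
  then have "empirical_measure n z
      = measure_of UNIV (sets borel) (emeasure (distr (uniform_count_measure {1..n}) borel z))"
    unfolding empirical_measure_def
    by (intro measure_of_eq) (auto simp: sets.sigma_sets_eq[of borel, simplified])
  also have "\<dots> = distr (uniform_count_measure {1..n}) borel z"
    using measure_of_of_measure[of "distr (uniform_count_measure {1..n}) borel z"] by simp
  finally show ?thesis .
qed

lemma prob_space_empirical_measure: "n \<ge> 1 \<Longrightarrow> prob_space (empirical_measure n z)"
  by (auto simp: empirical_measure_eq_distr intro!: prob_space.prob_space_distr
      prob_space_uniform_count_measure simp: measurable_def space_uniform_count_measure sets_uniform_count_measure)

lemma mse_eq_sum:
  assumes "n \<ge> 1"
  shows "mse n X Y \<beta> = (1 / real n) * (\<Sum>i=1..n. (Y i - \<beta> \<bullet> X i)\<^sup>2)"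
proof -
  have m: "(\<lambda>z. sq_loss (fst z) (snd z) \<beta>) \<in> borel_measurable borel"
    unfolding sq_loss_def by (intro borel_measurable_continuous_onI continuous_intros)
  have "mse n X Y \<beta> = (\<integral>i. sq_loss (X i) (Y i) \<beta> \<partial>uniform_count_measure {1..n})"
    unfolding mse_def empirical_measure_eq_distr[OF assms]
    by (subst integral_distr[OF _ m])
       (auto simp: measurable_def space_uniform_count_measure sets_uniform_count_measure)
  then show ?thesis
    unfolding uniform_count_measure_def
    by (simp add: lebesgue_integral_point_measure_finite sq_loss_def sum_distrib_left)
qed

end

theory Submission
  imports Defs
begin

text \<open>The identity holds for each \<open>\<beta>\<close> separately. Along any coupling one has
  \<open>y - \<beta> \<bullet> x = (v - \<beta> \<bullet> u) + \<beta> \<bullet> (u - x)\<close>, and the second term is at most the transport cost times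
  the dual norm of \<open>\<beta>\<close>; Minkowski's inequality in $L^2$ gives the upper bound. It is attained by
  moving every data point along the direction that is extremal in Hoelder's inequality for \<open>\<beta>\<close>, by an
  amount proportional to its residual.\<close>

section \<open>Duality of finite-dimensional norms\<close>

lemma lq_norm_nonneg: "lq_norm q x \<ge> 0"
  by (simp add: lq_norm_def infnorm_pos_le)

lemma lq_norm_ennreal:
  "0 \<le> r \<Longrightarrow> lq_norm (ennreal r) x = (\<Sum>i\<in>UNIV. \<bar>x $ i\<bar> powr r) powr (1 / r)"
  by (simp add: lq_norm_def)

lemma lq_norm_one: "lq_norm 1 x = (\<Sum>i\<in>UNIV. \<bar>x $ i\<bar>)"
  by (simp add: lq_norm_def sum_nonneg)

lemma lq_norm_powr:
  assumes "r > 0"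
  shows "lq_norm (ennreal r) x powr r = (\<Sum>i\<in>UNIV. \<bar>x $ i\<bar> powr r)"
  using assms by (simp add: lq_norm_ennreal powr_powr sum_nonneg)

lemma lq_norm_eq_0D:
  assumes "r > 0" "lq_norm (ennreal r) x = 0"
  shows "x = 0"
proof -
  have "(\<Sum>i\<in>UNIV. \<bar>x $ i\<bar> powr r) = 0"
    using assms lq_norm_powr[of r x] by simp
  then show ?thesis
    by (subst (asm) sum_nonneg_eq_0_iff) (auto simp: vec_eq_iff)
qed

lemma lq_norm_scaleR:
  assumes "q > 1"
  shows "lq_norm q (k *\<^sub>R x) = \<bar>k\<bar> * lq_norm q x"
proof (cases "q = \<infinity>")
  case True
  then show ?thesis by (simp add: lq_norm_def infnorm_mul)
next
  case False
  then have "enn2real q \<noteq> 0" using assms by (auto simp: enn2real_eq_0_iff)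
  then show ?thesis using False
    by (simp add: lq_norm_def abs_mult powr_mult powr_powr sum_nonneg flip: sum_distrib_left)
qed

text \<open>Reduces conjugacy in \<open>ennreal\<close> to the endpoint pair and to real exponents
  above 1. Since \<open>q > 1\<close>, the pair with \<open>p = \<infinity>\<close> cannot occur: it
  would force \<open>q = 1\<close>.\<close>

lemma conjugate_exponents_cases:
  fixes p q :: ennreal
  assumes "q > 1" "1 / p + 1 / q = 1"
  obtains "q = \<infinity>" "p = 1"
  | a b where "p = ennreal a" "q = ennreal b" "a > 1" "b > 1" "1 / a + 1 / b = 1"
proof (cases q)
  case top
  then have "1 / p = 1" using assms by simp
  then have "p = 1"
  proof (cases p)
    case (real r)
    then have "r > 0" using \<open>1 / p = 1\<close> by (cases "r = 0") auto
    then have "ennreal (1 / r) = ennreal 1"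
      using \<open>1 / p = 1\<close> real divide_ennreal[of 1 r] by simp
    then have "1 / r = 1" using \<open>r > 0\<close> by (subst (asm) ennreal_inj) auto
    then show ?thesis using real \<open>r > 0\<close> by simp
  qed (use \<open>1 / p = 1\<close> in simp)
  with top that show ?thesis by simp
next
  case (real b)
  then have b: "b > 1" using assms by simp
  show ?thesis
  proof (cases p)
    case top
    then have "ennreal (1 / b) = ennreal 1"
      using assms real b by (simp add: divide_ennreal flip: ennreal_1)
    then show ?thesis using b by (subst (asm) ennreal_inj) auto
  next
    case (real a)
    \<comment> \<open>In \<open>ennreal\<close>, \<open>1 / 0 = \<infinity>\<close>, so a zero
      exponent contradicts the sum being 1.\<close>
    then have "a \<noteq> 0" using assms by auto
    then have a: "a > 0" using real by simp
    have "ennreal (1 / a + 1 / b) = ennreal 1"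
      using assms real \<open>q = ennreal b\<close> a b by (simp add: divide_ennreal flip: ennreal_1 ennreal_plus)
    then have ab: "1 / a + 1 / b = 1" using a b by (subst (asm) ennreal_inj) auto
    moreover have "1 / b > 0" using b by simp
    ultimately have "1 / a < 1" by linarith
    then have "a > 1" using a by simp
    then show ?thesis using that ab real \<open>q = ennreal b\<close> b by blast
  qed
qed

text \<open>For real exponents, both vectors are scaled to unit norm and Young's inequality is
  summed over the coordinates. A vanishing norm forbids the scaling, but then the vector itself is
  zero.\<close>

lemma Hoelder_inequality_lq_norm:
  fixes p q :: ennreal and x \<beta> :: "real ^ 'd"
  assumes "q > 1" "1 / p + 1 / q = 1"
  shows "\<bar>\<beta> \<bullet> x\<bar> \<le> lq_norm p \<beta> * lq_norm q x"
  using assms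
proof (cases rule: conjugate_exponents_cases)
  case 1
  have "\<bar>\<beta> \<bullet> x\<bar> \<le> (\<Sum>i\<in>UNIV. \<bar>\<beta> $ i * x $ i\<bar>)"
    unfolding inner_vec_def inner_real_def by (rule sum_abs)
  also have "\<dots> \<le> (\<Sum>i\<in>UNIV. \<bar>\<beta> $ i\<bar> * infnorm x)"
    by (intro sum_mono) (auto simp: abs_mult component_le_infnorm_cart intro: mult_left_mono)
  finally show ?thesis
    using 1 by (simp add: lq_norm_one) (simp add: lq_norm_def sum_distrib_right)
next
  case (2 a b)
  define A where "A = lq_norm p \<beta>"
  define B where "B = lq_norm q x"
  have nn: "A \<ge> 0" "B \<ge> 0" by (simp_all add: A_def B_def lq_norm_nonneg)
  show ?thesis
  proof (cases "A = 0 \<or> B = 0")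
    case True
    then have "\<beta> = 0 \<or> x = 0"
      using lq_norm_eq_0D[of a \<beta>] lq_norm_eq_0D[of b x] 2 by (auto simp: A_def B_def)
    then show ?thesis by auto
  next
    case False
    then have pos: "A > 0" "B > 0" using nn by auto
    have "(\<Sum>i\<in>UNIV. (\<bar>\<beta> $ i\<bar> / A) * (\<bar>x $ i\<bar> / B))
        \<le> (\<Sum>i\<in>UNIV. (\<bar>\<beta> $ i\<bar> / A) powr a / a + (\<bar>x $ i\<bar> / B) powr b / b)"
      using 2 nn by (intro sum_mono Youngs_inequality) auto
    also have "\<dots> = (\<Sum>i\<in>UNIV. \<bar>\<beta> $ i\<bar> powr a) / A powr a / a + (\<Sum>i\<in>UNIV. \<bar>x $ i\<bar> powr b) / B powr b / b"
      using pos by (simp add: powr_divide sum.distrib sum_divide_distrib)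
    \<comment> \<open>By the normalisation the two sums are \<open>1 / a\<close> and
      \<open>1 / b\<close>.\<close>
    also have "\<dots> = 1"
      using lq_norm_powr[of a \<beta>, symmetric] lq_norm_powr[of b x, symmetric] 2 pos
      by (simp add: A_def B_def)
    finally have "(\<Sum>i\<in>UNIV. (\<bar>\<beta> $ i\<bar> / A) * (\<bar>x $ i\<bar> / B)) \<le> 1" .
    moreover have "(\<Sum>i\<in>UNIV. (\<bar>\<beta> $ i\<bar> / A) * (\<bar>x $ i\<bar> / B)) = (\<Sum>i\<in>UNIV. \<bar>\<beta> $ i\<bar> * \<bar>x $ i\<bar>) / (A * B)"
      by (simp add: sum_divide_distrib)
    ultimately have "(\<Sum>i\<in>UNIV. \<bar>\<beta> $ i\<bar> * \<bar>x $ i\<bar>) \<le> A * B"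
      using pos by (simp add: pos_divide_le_eq)
    moreover have "\<bar>\<beta> \<bullet> x\<bar> \<le> (\<Sum>i\<in>UNIV. \<bar>\<beta> $ i\<bar> * \<bar>x $ i\<bar>)"
      unfolding inner_vec_def inner_real_def abs_mult[symmetric] by (rule sum_abs)
    ultimately show ?thesis by (simp add: A_def B_def)
  qed
qed

text \<open>The equality case of Hoelder's inequality, giving the direction in which moving the data
  is most harmful. Asking only for norm at most 1 lets \<open>\<beta> = 0\<close> be served by the
  zero vector.\<close>

lemma Hoelder_extremal_vector:
  fixes p q :: ennreal and \<beta> :: "real ^ 'd"
  assumes "q > 1" "1 / p + 1 / q = 1"
  obtains w :: "real ^ 'd" where "lq_norm q w \<le> 1" "\<beta> \<bullet> w = lq_norm p \<beta>"
  using assms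
proof (cases rule: conjugate_exponents_cases)
  case 1
  define w :: "real ^ 'd" where "w = (\<chi> i. sgn (\<beta> $ i))"
  have "lq_norm q w \<le> 1"
    using 1 by (auto simp: lq_norm_def infnorm_cart w_def abs_sgn_eq intro!: cSup_least)
  moreover have "\<beta> \<bullet> w = lq_norm p \<beta>"
    using 1 by (simp add: lq_norm_one w_def inner_vec_def abs_sgn)
  ultimately show ?thesis by (rule that)
next
  case (2 a b)
  define A where "A = lq_norm p \<beta>"
  show ?thesis
  proof (cases "A = 0")
    case True
    then show ?thesis using that[of 0] by (simp add: A_def lq_norm_eq_0D)
  next
    case False
    then have A: "A > 0" using lq_norm_nonneg[of p \<beta>] by (simp add: A_def)
    have Aa: "(\<Sum>i\<in>UNIV. \<bar>\<beta> $ i\<bar> powr a) = A powr a"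
      using lq_norm_powr[of a \<beta>] 2 by (simp add: A_def)
    \<comment> \<open>Equality in Young's inequality requires
      \<open>\<bar>w $ i\<bar> powr b\<close> to equal
      \<open>(\<bar>\<beta> $ i\<bar> / A) powr a\<close>; since \<open>(a - 1) * b = a\<close>, the
      exponent \<open>a - 1\<close> achieves this.\<close>
    define w :: "real ^ 'd" where "w = (\<chi> i. sgn (\<beta> $ i) * (\<bar>\<beta> $ i\<bar> / A) powr (a - 1))"
    have ab: "(a - 1) * b = a"
      using 2 by (simp add: field_simps)
    have "\<bar>w $ i\<bar> powr b = \<bar>\<beta> $ i\<bar> powr a / A powr a" for i
      using A 2 ab by (cases "\<beta> $ i = 0") (auto simp: w_def abs_mult abs_sgn_eq powr_powr powr_divide)
    then have "(\<Sum>i\<in>UNIV. \<bar>w $ i\<bar> powr b) = 1"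
      using A by (simp add: Aa flip: sum_divide_distrib)
    then have "lq_norm q w \<le> 1"
      using 2 by (simp add: lq_norm_ennreal)
    moreover have "\<beta> $ i * w $ i = A * (\<bar>\<beta> $ i\<bar> powr a / A powr a)" for i
    proof (cases "\<beta> $ i = 0")
      case False
      have "\<beta> $ i * w $ i = A * ((\<bar>\<beta> $ i\<bar> / A) * (\<bar>\<beta> $ i\<bar> / A) powr (a - 1))"
        using A by (simp add: w_def abs_sgn)
      also have "(\<bar>\<beta> $ i\<bar> / A) * (\<bar>\<beta> $ i\<bar> / A) powr (a - 1) = (\<bar>\<beta> $ i\<bar> / A) powr a"
        using A False powr_mult_base[of "\<bar>\<beta> $ i\<bar> / A" "a - 1"] by simp
      finally show ?thesis using A by (simp add: powr_divide)
    qed simp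
    then have "\<beta> \<bullet> w = A"
      using A by (simp add: inner_vec_def Aa flip: sum_distrib_left sum_divide_distrib)
    ultimately show ?thesis using that A_def by blast
  qed
qed

section \<open>Worst-case expected loss for a fixed parameter\<close>

lemma nn_integral_uniform_count_measure:
  fixes g :: "'a \<Rightarrow> real"
  assumes "finite A" "A \<noteq> {}" "\<And>i. i \<in> A \<Longrightarrow> g i \<ge> 0"
  shows "(\<integral>\<^sup>+ i. ennreal (g i) \<partial>uniform_count_measure A) = ennreal ((\<Sum>i\<in>A. g i) / card A)"
  using assms unfolding uniform_count_measure_def
  by (simp add: nn_integral_point_measure_finite sum_divide_distrib flip: ennreal_mult sum_ennreal)

lemma measurable_uniform_count_measure [measurable]:
  "f \<in> measurable (uniform_count_measure A) M \<longleftrightarrow> f \<in> A \<rightarrow> space M"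
  by (auto simp: measurable_def space_uniform_count_measure sets_uniform_count_measure)

lemma borel_measurable_sq_loss [measurable]:
  "(\<lambda>z. sq_loss (fst z) (snd z) \<beta>) \<in> borel_measurable borel"
  unfolding sq_loss_def by (intro borel_measurable_continuous_onI continuous_intros)

lemma borel_measurable_fst_borel [measurable]:
  "fst \<in> borel_measurable (borel :: ('a::second_countable_topology \<times> 'a) measure)"
  by (intro borel_measurable_continuous_onI continuous_intros)

lemma borel_measurable_snd_borel [measurable]:
  "snd \<in> borel_measurable (borel :: ('a::second_countable_topology \<times> 'a) measure)"
  by (intro borel_measurable_continuous_onI continuous_intros)

lemma sq_loss_nonneg: "sq_loss x y \<beta> \<ge> 0"
  by (simp add: sq_loss_def)

lemma mse_nonneg: "mse n X Y \<beta> \<ge> 0"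
  by (simp add: mse_def sq_loss_def)

text \<open>Links the Bochner integral in \<open>mse\<close> with the extended nonnegative integral
  used for the worst case. It serves the data marginal of a coupling as well as the shifted
  data.\<close>

lemma nn_integral_empirical_sq_loss:
  fixes X :: "nat \<Rightarrow> real ^ 'd"
  assumes "n \<ge> 1"
  shows "(\<integral>\<^sup>+ z. ennreal (sq_loss (fst z) (snd z) \<beta>) \<partial>empirical_measure n (\<lambda>i. (X i, Y i)))
    = ennreal (mse n X Y \<beta>)"
  using assms nn_integral_uniform_count_measure[of "{1..n}" "\<lambda>i. sq_loss (X i) (Y i) \<beta>"]
  unfolding empirical_measure_eq_distr[OF assms] mse_eq_sum[OF assms]
  by (subst nn_integral_distr) (auto simp: sq_loss_nonneg, simp add: sq_loss_def)

section \<open>Upper bound over all feasible distributions\<close>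

text \<open>Integrated, this bound is exact for \<open>s\<close> and \<open>c\<close> equal to the $L^2$ norms of \<open>a\<close> and \<open>b\<close>, so it
  replaces Minkowski's inequality.\<close>
lemma square_sum_le_weighted:
  fixes a b s c :: real
  assumes "s > 0" "c > 0"
  shows "(a + b)\<^sup>2 \<le> ((s + c) / s) * a\<^sup>2 + ((s + c) / c) * b\<^sup>2"
proof -
  have "((s + c) / s) * a\<^sup>2 + ((s + c) / c) * b\<^sup>2 - (a + b)\<^sup>2 = (c * a - s * b)\<^sup>2 / (s * c)"
    using assms by (simp add: field_simps power2_eq_square)
  moreover have "\<dots> \<ge> 0" using assms by simp
  ultimately show ?thesis by linarith
qed

text \<open>The pointwise form of the upper bound, ready to be integrated along a coupling. Here
  \<open>B\<close> majorises the dual norm of \<open>\<beta>\<close>, while \<open>s\<close> and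
  \<open>r\<close> stand for the root mean square residual and the root of the transport
  budget.\<close>

lemma sq_loss_le_transport_cost:
  fixes x u \<beta> :: "real ^ 'd"
  assumes "q > 1" "1 / p + 1 / q = 1" "lq_norm p \<beta> \<le> B" "B > 0" "s > 0" "r > 0"
  shows "ennreal (sq_loss x y \<beta>) \<le>
    ennreal ((s + B * r) / s) * ennreal (sq_loss u v \<beta>)
    + ennreal ((s + B * r) / (B * r) * B\<^sup>2) * (N_cost q (x, y) (u, v))\<^sup>2"
proof (cases "y = v")
  case False
  \<comment> \<open>The coefficient must be nonzero, since \<open>0 * \<infinity> = 0\<close> in
    \<open>ennreal\<close>; being positive, it makes the right-hand side infinite.\<close>
  have "(s + B * r) / (B * r) * B\<^sup>2 > 0"
    using assms by (intro mult_pos_pos divide_pos_pos add_pos_pos) auto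
  then show ?thesis using False by (simp add: N_cost_def ennreal_mult_top power2_eq_square)
next
  case True
  define m where "m = lq_norm q (x - u)"
  have m: "m \<ge> 0" by (simp add: m_def lq_norm_nonneg)
  have "\<bar>\<beta> \<bullet> (u - x)\<bar> = \<bar>\<beta> \<bullet> (x - u)\<bar>" by (simp add: inner_diff_right)
  also have "\<dots> \<le> lq_norm p \<beta> * m"
    unfolding m_def using assms by (intro Hoelder_inequality_lq_norm)
  also have "\<dots> \<le> B * m" using assms m by (intro mult_right_mono)
  finally have "(\<beta> \<bullet> (u - x))\<^sup>2 \<le> (B * m)\<^sup>2"
    by (metis abs_ge_zero power2_abs power_mono)
  then have b: "(s + B * r) / (B * r) * (\<beta> \<bullet> (u - x))\<^sup>2 \<le> (s + B * r) / (B * r) * (B\<^sup>2 * m\<^sup>2)"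
    using assms by (intro mult_left_mono) (auto simp: power_mult_distrib)
  have "sq_loss x y \<beta> = ((v - \<beta> \<bullet> u) + \<beta> \<bullet> (u - x))\<^sup>2"
    by (simp add: sq_loss_def True inner_diff_right)
  \<comment> \<open>The weight \<open>c = B * r\<close> is the largest $L^2$ norm that the
    displacement term can have under a budget of \<open>r\<^sup>2\<close>.\<close>
  also have "\<dots> \<le> (s + B * r) / s * (v - \<beta> \<bullet> u)\<^sup>2 + (s + B * r) / (B * r) * (\<beta> \<bullet> (u - x))\<^sup>2"
    using assms by (intro square_sum_le_weighted) auto
  also have "\<dots> \<le> (s + B * r) / s * sq_loss u v \<beta> + (s + B * r) / (B * r) * B\<^sup>2 * m\<^sup>2"
    using b by (simp add: sq_loss_def mult.assoc)
  finally have "ennreal (sq_loss x y \<beta>)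
      \<le> ennreal ((s + B * r) / s * sq_loss u v \<beta> + (s + B * r) / (B * r) * B\<^sup>2 * m\<^sup>2)"
    by (rule ennreal_leI)
  also have "\<dots> = ennreal ((s + B * r) / s) * ennreal (sq_loss u v \<beta>)
      + ennreal ((s + B * r) / (B * r) * B\<^sup>2) * (ennreal m)\<^sup>2"
  proof -
    have nn: "(s + B * r) / s \<ge> 0" "(s + B * r) / (B * r) * B\<^sup>2 \<ge> 0" "sq_loss u v \<beta> \<ge> 0"
      using assms by (simp_all add: sq_loss_def)
    show ?thesis
      using m by (simp only: ennreal_plus ennreal_mult ennreal_power mult_nonneg_nonneg nn zero_le_power2)
  qed
  finally show ?thesis by (simp add: N_cost_def True m_def)
qed

text \<open>The pointwise bound is integrated along a nearly optimal coupling, with all three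
  parameters enlarged by \<epsilon>, and then \<epsilon> tends to 0. The enlargement keeps the
  divisors positive when the residuals or \<open>\<beta>\<close> vanish, and avoids assuming that
  the infimum over couplings is attained.\<close>

lemma expected_sq_loss_le:
  fixes X :: "nat \<Rightarrow> real ^ 'd" and P :: "((real ^ 'd) \<times> real) measure"
  assumes n: "n \<ge> 1" and \<delta>: "\<delta> > 0" and q: "q > 1" "1 / p + 1 / q = 1"
    and P: "ot_discrepancy (\<lambda>z w. (N_cost q z w)\<^sup>2) P (empirical_measure n (\<lambda>i. (X i, Y i))) \<le> ennreal \<delta>"
  shows "(\<integral>\<^sup>+ z. ennreal (sq_loss (fst z) (snd z) \<beta>) \<partial>P)
    \<le> ennreal ((sqrt (mse n X Y \<beta>) + sqrt \<delta> * lq_norm p \<beta>)\<^sup>2)"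
    (is "?I \<le> ennreal ((?s + ?r * ?B)\<^sup>2)")
proof -
  have bound: "?I \<le> ennreal (((?s + \<epsilon>) + (?B + \<epsilon>) * (?r + \<epsilon>))\<^sup>2)" if "\<epsilon> > 0" for \<epsilon>
  proof -
    define s r B where "s = ?s + \<epsilon>" and "r = ?r + \<epsilon>" and "B = ?B + \<epsilon>"
    have nn: "?s \<ge> 0" "?r \<ge> 0" "?B \<ge> 0" using \<delta> by (simp_all add: mse_nonneg lq_norm_nonneg)
    have pos: "s > 0" "r > 0" "B > 0" 
      using that nn unfolding s_def r_def B_def by linarith+
    have s2: "mse n X Y \<beta> \<le> s\<^sup>2"
      using that power_mono[of ?s s 2] by (simp add: s_def mse_nonneg)
    have "?r\<^sup>2 < r\<^sup>2" using that nn by (intro power_strict_mono) (auto simp: r_def)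
    then have r2: "\<delta> < r\<^sup>2" using \<delta> by simp
    then have "ot_discrepancy (\<lambda>z w. (N_cost q z w)\<^sup>2) P (empirical_measure n (\<lambda>i. (X i, Y i))) < ennreal (r\<^sup>2)"
      using P \<delta> by (meson ennreal_lessI le_less_trans less_trans)
    \<comment> \<open>An infimum strictly below \<open>r\<^sup>2\<close> yields an actual coupling
      whose cost is below \<open>r\<^sup>2\<close>.\<close>
    then obtain \<pi> where \<pi>: "\<pi> \<in> couplings P (empirical_measure n (\<lambda>i. (X i, Y i)))"
      and cost: "(\<integral>\<^sup>+ z. (N_cost q (fst z) (snd z))\<^sup>2 \<partial>\<pi>) < ennreal (r\<^sup>2)"
      by (auto simp: ot_discrepancy_def INF_less_iff)
    have [measurable_cong]: "sets \<pi> = sets borel"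
      and fst: "distr \<pi> borel fst = P"
      and snd: "distr \<pi> borel snd = empirical_measure n (\<lambda>i. (X i, Y i))"
      using \<pi> by (auto simp: couplings_def)
    note [measurable] = borel_measurable_N_cost
    have "?I = (\<integral>\<^sup>+ z. ennreal (sq_loss (fst (fst z)) (snd (fst z)) \<beta>) \<partial>\<pi>)"
      unfolding fst[symmetric] by (subst nn_integral_distr) auto
    also have "\<dots> \<le> (\<integral>\<^sup>+ z. ennreal ((s + B * r) / s) * ennreal (sq_loss (fst (snd z)) (snd (snd z)) \<beta>)
        + ennreal ((s + B * r) / (B * r) * B\<^sup>2) * (N_cost q (fst z) (snd z))\<^sup>2 \<partial>\<pi>)"
    proof (rule nn_integral_mono)
      fix z :: "((real ^ 'd) \<times> real) \<times> ((real ^ 'd) \<times> real)"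
      show "ennreal (sq_loss (fst (fst z)) (snd (fst z)) \<beta>)
        \<le> ennreal ((s + B * r) / s) * ennreal (sq_loss (fst (snd z)) (snd (snd z)) \<beta>)
          + ennreal ((s + B * r) / (B * r) * B\<^sup>2) * (N_cost q (fst z) (snd z))\<^sup>2"
        using sq_loss_le_transport_cost[of q p \<beta> B s r "fst (fst z)" "snd (fst z)" "fst (snd z)" "snd (snd z)"]
          q pos that by (simp add: B_def)
    qed
    also have "\<dots> = ennreal ((s + B * r) / s) * (\<integral>\<^sup>+ z. ennreal (sq_loss (fst (snd z)) (snd (snd z)) \<beta>) \<partial>\<pi>)
        + ennreal ((s + B * r) / (B * r) * B\<^sup>2) * (\<integral>\<^sup>+ z. (N_cost q (fst z) (snd z))\<^sup>2 \<partial>\<pi>)"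
      by (simp add: nn_integral_add nn_integral_cmult)
    also have "(\<integral>\<^sup>+ z. ennreal (sq_loss (fst (snd z)) (snd (snd z)) \<beta>) \<partial>\<pi>)
        = (\<integral>\<^sup>+ z. ennreal (sq_loss (fst z) (snd z) \<beta>) \<partial>distr \<pi> borel snd)"
      by (subst nn_integral_distr) auto
    also have "\<dots> = ennreal (mse n X Y \<beta>)"
      unfolding snd using n by (rule nn_integral_empirical_sq_loss)
    also have "ennreal ((s + B * r) / s) * ennreal (mse n X Y \<beta>)
        + ennreal ((s + B * r) / (B * r) * B\<^sup>2) * (\<integral>\<^sup>+ z. (N_cost q (fst z) (snd z))\<^sup>2 \<partial>\<pi>)
        \<le> ennreal ((s + B * r) / s) * ennreal (s\<^sup>2) + ennreal ((s + B * r) / (B * r) * B\<^sup>2) * ennreal (r\<^sup>2)"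
      using s2 cost by (intro add_mono mult_left_mono ennreal_leI) auto
    also have "\<dots> = ennreal ((s + B * r) / s * s\<^sup>2 + (s + B * r) / (B * r) * B\<^sup>2 * r\<^sup>2)"
    proof -
      have "(s + B * r) / s \<ge> 0" "(s + B * r) / (B * r) * B\<^sup>2 \<ge> 0" using pos by simp_all
      then show ?thesis by (simp only: ennreal_plus ennreal_mult mult_nonneg_nonneg zero_le_power2)
    qed
    \<comment> \<open>The weights cancel: the left side is
      \<open>(s + B * r) * s + (s + B * r) * (B * r)\<close>.\<close>
    also have "(s + B * r) / s * s\<^sup>2 + (s + B * r) / (B * r) * B\<^sup>2 * r\<^sup>2 = (s + B * r)\<^sup>2"
      using pos by (simp add: field_simps power2_eq_square)
    finally show ?thesis by (simp add: s_def r_def B_def)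
  qed
  have lim: "((\<lambda>\<epsilon>. ennreal (((?s + \<epsilon>) + (?B + \<epsilon>) * (?r + \<epsilon>))\<^sup>2))
      \<longlongrightarrow> ennreal (((?s + 0) + (?B + 0) * (?r + 0))\<^sup>2)) (at_right 0)"
    by (intro tendsto_ennrealI tendsto_intros)
  have "?I \<le> ennreal (((?s + 0) + (?B + 0) * (?r + 0))\<^sup>2)"
    by (rule tendsto_lowerbound[OF lim])
      (auto intro: eventually_mono[OF eventually_at_right_less bound])
  then show ?thesis by (simp add: mult.commute)
qed

section \<open>Attainment by shifted data\<close>

text \<open>Pairing each shifted point with its origin gives a coupling. Responses stay fixed, so
  the cost is finite, and point \<open>i\<close> contributes at most \<open>(k i)\<^sup>2\<close>
  because \<open>w\<close> lies in the unit ball.\<close>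

lemma shifted_data_feasible:
  fixes X :: "nat \<Rightarrow> real ^ 'd"
  assumes n: "n \<ge> 1" and q: "q > 1" and w: "lq_norm q w \<le> 1"
    and k: "(\<Sum>i=1..n. (k i)\<^sup>2) / n \<le> \<delta>"
  shows "ot_discrepancy (\<lambda>z w. (N_cost q z w)\<^sup>2)
    (empirical_measure n (\<lambda>i. (X i - k i *\<^sub>R w, Y i))) (empirical_measure n (\<lambda>i. (X i, Y i))) \<le> ennreal \<delta>"
proof -
  let ?U = "uniform_count_measure {1..n}"
  \<comment> \<open>A single uniform index drives both components, so each projection pushes \<pi>
    forward to the corresponding empirical measure.\<close>
  define \<pi> where "\<pi> = distr ?U borel (\<lambda>i. ((X i - k i *\<^sub>R w, Y i), (X i, Y i)))"
  note [measurable] = borel_measurable_N_cost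
  have "prob_space ?U" using n by (intro prob_space_uniform_count_measure) auto
  then have ps: "prob_space \<pi>" unfolding \<pi>_def by (rule prob_space.prob_space_distr) auto
  have "\<pi> \<in> couplings (empirical_measure n (\<lambda>i. (X i - k i *\<^sub>R w, Y i))) (empirical_measure n (\<lambda>i. (X i, Y i)))"
    using ps unfolding couplings_def \<pi>_def empirical_measure_eq_distr[OF n]
    by (auto simp: distr_distr comp_def)
  then have "ot_discrepancy (\<lambda>z w. (N_cost q z w)\<^sup>2)
      (empirical_measure n (\<lambda>i. (X i - k i *\<^sub>R w, Y i))) (empirical_measure n (\<lambda>i. (X i, Y i)))
      \<le> (\<integral>\<^sup>+ z. (N_cost q (fst z) (snd z))\<^sup>2 \<partial>\<pi>)"
    unfolding ot_discrepancy_def by (rule INF_lower)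
  also have "\<dots> = (\<integral>\<^sup>+ i. ennreal ((lq_norm q (- k i *\<^sub>R w))\<^sup>2) \<partial>?U)"
    unfolding \<pi>_def
    by (subst nn_integral_distr) (auto, simp add: N_cost_def ennreal_power lq_norm_nonneg)
  also have "\<dots> \<le> (\<integral>\<^sup>+ i. ennreal ((k i)\<^sup>2) \<partial>?U)"
  proof (intro nn_integral_mono ennreal_leI)
    fix i
    have "lq_norm q (- k i *\<^sub>R w) \<le> \<bar>k i\<bar>"
      using mult_left_mono[OF w, of "\<bar>k i\<bar>"] q unfolding lq_norm_scaleR[OF q] by simp
    then show "(lq_norm q (- k i *\<^sub>R w))\<^sup>2 \<le> (k i)\<^sup>2"
      by (metis lq_norm_nonneg power2_abs power_mono)
  qed
  also have "\<dots> = ennreal ((\<Sum>i=1..n. (k i)\<^sup>2) / n)"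
    using n by (simp add: nn_integral_uniform_count_measure)
  also have "\<dots> \<le> ennreal \<delta>" using k by (rule ennreal_leI)
  finally show ?thesis .
qed

text \<open>The equality case of Minkowski's inequality: a perturbation proportional to the
  residuals \<open>r\<close> makes the two $L^2$ norms add up.\<close>

lemma exists_aligned_perturbation:
  fixes r :: "nat \<Rightarrow> real"
  assumes n: "n \<ge> 1" and \<delta>: "\<delta> > 0" and M: "M = (\<Sum>i=1..n. (r i)\<^sup>2) / n"
  obtains k where "(\<Sum>i=1..n. (k i)\<^sup>2) / n \<le> \<delta>"
    "(\<Sum>i=1..n. (r i + k i * B)\<^sup>2) / n = (sqrt M + sqrt \<delta> * B)\<^sup>2"
proof (cases "M = 0")
  case True
  then have "(\<Sum>i=1..n. (r i)\<^sup>2) = 0" using n M by simp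
  then have "r i = 0" if "i \<in> {1..n}" for i
    using that by (subst (asm) sum_nonneg_eq_0_iff) auto
  \<comment> \<open>With all residuals zero there is nothing to align with, and a constant shift
    spends the whole budget.\<close>
  then show ?thesis using that[of "\<lambda>_. sqrt \<delta>"] n \<delta> True by simp
next
  case False
  moreover have "M \<ge> 0" unfolding M by (simp add: sum_nonneg)
  ultimately have Mpos: "M > 0" by simp
  have sum: "(\<Sum>i=1..n. (c * r i)\<^sup>2) / n = c\<^sup>2 * M" for c
    by (simp add: M power_mult_distrib flip: sum_distrib_left)
  \<comment> \<open>The factor for which the mean of \<open>(c * r i)\<^sup>2\<close>, namely
    \<open>c\<^sup>2 * M\<close>, is exactly \<delta>.\<close>
  define c where "c = sqrt \<delta> / sqrt M"
  have "(\<Sum>i=1..n. (c * r i)\<^sup>2) / n = \<delta>"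
    using Mpos \<delta> unfolding sum by (simp add: c_def power_divide)
  moreover have "(\<Sum>i=1..n. (r i + c * r i * B)\<^sup>2) / n = (sqrt M + sqrt \<delta> * B)\<^sup>2"
  proof -
    have "(\<Sum>i=1..n. (r i + c * r i * B)\<^sup>2) / n = (\<Sum>i=1..n. ((1 + c * B) * r i)\<^sup>2) / n"
      by (simp only: distrib_right distrib_left mult_1_left mult_1_right mult_ac)
    also have "\<dots> = (1 + c * B)\<^sup>2 * (sqrt M)\<^sup>2"
      using Mpos unfolding sum by simp
    also have "\<dots> = ((1 + c * B) * sqrt M)\<^sup>2"
      by (simp only: power_mult_distrib)
    also have "(1 + c * B) * sqrt M = sqrt M + sqrt \<delta> * B"
      using Mpos by (simp add: c_def field_simps)
    finally show ?thesis .
  qed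
  ultimately show ?thesis using that[of "\<lambda>i. c * r i"] by simp
qed

lemma worst_case_distribution:
  fixes X :: "nat \<Rightarrow> real ^ 'd"
  assumes n: "n \<ge> 1" and \<delta>: "\<delta> > 0" and q: "q > 1" "1 / p + 1 / q = 1"
  obtains P :: "((real ^ 'd) \<times> real) measure" where "prob_space P" "sets P = sets borel"
    "ot_discrepancy (\<lambda>z w. (N_cost q z w)\<^sup>2) P (empirical_measure n (\<lambda>i. (X i, Y i))) \<le> ennreal \<delta>"
    "(\<integral>\<^sup>+ z. ennreal (sq_loss (fst z) (snd z) \<beta>) \<partial>P)
      = ennreal ((sqrt (mse n X Y \<beta>) + sqrt \<delta> * lq_norm p \<beta>)\<^sup>2)"
proof -
  obtain w :: "real ^ 'd" where w: "lq_norm q w \<le> 1" "\<beta> \<bullet> w = lq_norm p \<beta>"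
    using Hoelder_extremal_vector[OF q] .
  have M: "mse n X Y \<beta> = (\<Sum>i=1..n. (Y i - \<beta> \<bullet> X i)\<^sup>2) / n"
    using n by (simp add: mse_eq_sum)
  obtain k where k: "(\<Sum>i=1..n. (k i)\<^sup>2) / n \<le> \<delta>"
    "(\<Sum>i=1..n. (Y i - \<beta> \<bullet> X i + k i * lq_norm p \<beta>)\<^sup>2) / n
      = (sqrt (mse n X Y \<beta>) + sqrt \<delta> * lq_norm p \<beta>)\<^sup>2"
    using exists_aligned_perturbation[OF n \<delta> M] .
  let ?P = "empirical_measure n (\<lambda>i. (X i - k i *\<^sub>R w, Y i))"
  \<comment> \<open>Shifting by \<open>- k i *\<^sub>R w\<close> adds
    \<open>k i * (\<beta> \<bullet> w)\<close>, that is \<open>k i * lq_norm p \<beta>\<close>, to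
    the residual of point \<open>i\<close>.\<close>
  have "mse n (\<lambda>i. X i - k i *\<^sub>R w) Y \<beta> = (sqrt (mse n X Y \<beta>) + sqrt \<delta> * lq_norm p \<beta>)\<^sup>2"
    using k(2) n w(2) by (simp add: mse_eq_sum inner_diff_right algebra_simps)
  then have "(\<integral>\<^sup>+ z. ennreal (sq_loss (fst z) (snd z) \<beta>) \<partial>?P)
      = ennreal ((sqrt (mse n X Y \<beta>) + sqrt \<delta> * lq_norm p \<beta>)\<^sup>2)"
    using n by (simp add: nn_integral_empirical_sq_loss)
  moreover have "sets ?P = sets borel" using n by (simp add: empirical_measure_eq_distr)
  ultimately show ?thesis
    using that[of ?P] prob_space_empirical_measure[OF n] shifted_data_feasible[OF n q(1) w(1) k(1)]
    by blast
qed

text \<open>Both sides take values in \<open>ennreal\<close>: with the nonnegative integral, an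
  infinite expected loss would count as \<infinity>, whereas the Bochner integral would assign it
  the default value 0.\<close>

theorem theorem1:
  fixes n :: nat and X :: "nat \<Rightarrow> real ^ 'd" and Y :: "nat \<Rightarrow> real"
    and \<delta> :: real and p q :: ennreal
  assumes "n \<ge> 1" and "\<delta> > 0" and "q > 1" and "1 / p + 1 / q = 1"
  shows "(INF \<beta>::real ^ 'd.
            SUP P\<in>{P :: ((real ^ 'd) \<times> real) measure. prob_space P \<and> sets P = sets borel \<and>
                     ot_discrepancy (\<lambda>z w. (N_cost q z w)\<^sup>2) P
                       (empirical_measure n (\<lambda>i. (X i, Y i))) \<le> ennreal \<delta>}.
              \<integral>\<^sup>+ z. ennreal (sq_loss (fst z) (snd z) \<beta>) \<partial>P)
         = (INF \<beta>::real ^ 'd. ennreal ((sqrt (mse n X Y \<beta>) + sqrt \<delta> * lq_norm p \<beta>)\<^sup>2))"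
proof (rule INF_cong[OF refl])
  fix \<beta> :: "real ^ 'd"
  obtain P :: "((real ^ 'd) \<times> real) measure" where "prob_space P" "sets P = sets borel"
    "ot_discrepancy (\<lambda>z w. (N_cost q z w)\<^sup>2) P (empirical_measure n (\<lambda>i. (X i, Y i))) \<le> ennreal \<delta>"
    "(\<integral>\<^sup>+ z. ennreal (sq_loss (fst z) (snd z) \<beta>) \<partial>P)
      = ennreal ((sqrt (mse n X Y \<beta>) + sqrt \<delta> * lq_norm p \<beta>)\<^sup>2)"
    using worst_case_distribution[OF assms] .
  then show "(SUP P\<in>{P :: ((real ^ 'd) \<times> real) measure. prob_space P \<and> sets P = sets borel \<and>
        ot_discrepancy (\<lambda>z w. (N_cost q z w)\<^sup>2) P (empirical_measure n (\<lambda>i. (X i, Y i))) \<le> ennreal \<delta>}.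
      \<integral>\<^sup>+ z. ennreal (sq_loss (fst z) (snd z) \<beta>) \<partial>P)
    = ennreal ((sqrt (mse n X Y \<beta>) + sqrt \<delta> * lq_norm p \<beta>)\<^sup>2)"
    \<comment> \<open>The upper bound covers every feasible distribution, and \<open>P\<close>
      attains it, so the supremum is a maximum.\<close>
    by (intro antisym SUP_least expected_sq_loss_le[OF assms] SUP_upper2[of P]) auto
qed

end
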